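(* Every 3-dimensional almost paracontact almost paracomplex Riemannian manifold $(\mathcal{M},\phi,\xi,\eta,g)$ belongs to one of the basic classes $\mathcal{F}_1,\mathcal{F}_4,\mathcal{F}_5,\mathcal{F}_8,\mathcal{F}_9,\mathcal{F}_{10},\mathcal{F}_{11}$ or to a direct sum of them; i.e. its fundamental tensor satisfies $F=F_1+F_4+F_5+F_8+F_9+F_{10}+F_{11}$.
   Context: Let $n\ge 1$. An almost paracontact almost paracomplex Riemannian manifold $(\mathcal{M},\phi,\xi,\eta,g)$ is a $(2n+1)$-dimensional smooth manifold with a $(1,1)$-tensor field $\phi$, a vector field $\xi$ and a 1-form $\eta$ such that $\phi\xi=0$, $\phi^2=I-\eta\otimes\xi$, $\eta\circ\phi=0$, $\eta(\xi)=1$, $\mathrm{tr}\,\phi=0$, and a Riemannian metric $g$ with $g(\phi x,\phi y)=g(x,y)-\eta(x)\eta(y)$, $g(x,\xi)=\eta(x)$. Dimension 3 is the case $n=1$. With $\nabla$ the Levi-Civita connection of $g$, the fundamental tensor is $F(x,y,z)=g((\nabla_x\phi)y,z)$. Lee forms: for an orthonormal basis $e_1,\dots,e_{2n}$ of $\ker\eta$ at a point, $\theta(z)=\sum_{i=1}^{2n}F(e_i,e_i,z)$, $\theta^*(z)=\sum_{i=1}^{2n}F(e_i,\phi e_i,z)$, $\omega(z)=F(\xi,\xi,z)$. Components of $F$. For a $(0,2)$-tensor $S$ put $[S](x,y,z)=S(x,y)\eta(z)+S(x,z)\eta(y)$; put $b(x,y)=F(\phi^2x,\phi^2y,\xi)$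 and $c(x,y)=F(\phi x,\phi y,\xi)$. Then $F_1(x,y,z)=\frac1{2n}\{g(\phi x,\phi y)\theta(\phi^2z)+g(\phi x,\phi z)\theta(\phi^2y)-g(x,\phi y)\theta(\phi z)-g(x,\phi z)\theta(\phi y)\}$; $F_2(x,y,z)=\frac14\{2F(\phi^2x,\phi^2y,\phi^2z)+F(\phi^2y,\phi^2z,\phi^2x)+F(\phi^2z,\phi^2x,\phi^2y)-F(\phi y,\phi z,\phi^2x)-F(\phi z,\phi y,\phi^2x)\}-F_1(x,y,z)$; $F_3(x,y,z)=\frac14\{2F(\phi^2x,\phi^2y,\phi^2z)-F(\phi^2y,\phi^2z,\phi^2x)-F(\phi^2z,\phi^2x,\phi^2y)+F(\phi y,\phi z,\phi^2x)+F(\phi z,\phi y,\phi^2x)\}$; $F_4=\frac{\theta(\xi)}{2n}[S]$ with $S(x,y)=g(\phi x,\phi y)$; $F_5=\frac{\theta^*(\xi)}{2n}[S]$ with $S(x,y)=g(x,\phi y)$; $F_6=\frac14[S]-F_4-F_5$ with $S(x,y)=b(x,y)+b(y,x)+c(x,y)+c(y,x)$; $F_7=\frac14[S]$ with $S(x,y)=b(x,y)-b(y,x)+c(x,y)-c(y,x)$; $F_8=\frac14[S]$ with $S(x,y)=b(x,y)+b(y,x)-c(x,y)-c(y,x)$; $F_9=\frac14[S]$ with $S(x,y)=b(x,y)-b(y,x)-c(x,y)+c(y,x)$; $F_{10}(x,y,z)=\eta(x)F(\xi,\phi^2y,\phi^2z)$; $F_{11}(x,y,z)=\eta(x)\{\eta(y)\omega(z)+\eta(z)\omega(y)\}$.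 The manifold belongs to the basic class $\mathcal{F}_i$ if $F=F_i$, and to $\mathcal{F}_i\oplus\mathcal{F}_j\oplus\cdots$ if $F=F_i+F_j+\cdots$. *)

theory Defs
  imports "HOL-Analysis.Analysis"
begin

section \<open>Smooth maps between open sets of normed spaces\<close>

text \<open>For open \<open>S\<close> in a finite-dimensional space, \<open>Ck_on k S f\<close> says that \<open>f\<close> is of class
  \<open>C\<^sup>k\<close> on \<open>S\<close>.\<close>

primrec Ck_on :: "nat \<Rightarrow> 'a::euclidean_space set \<Rightarrow> ('a \<Rightarrow> 'b::real_normed_vector) \<Rightarrow> bool" where
  "Ck_on 0 S f \<longleftrightarrow> continuous_on S f"
| "Ck_on (Suc k) S f \<longleftrightarrow>
     (\<forall>x\<in>S. f differentiable (at x)) \<and> (\<forall>v. Ck_on k S (\<lambda>x. frechet_derivative f (at x) v))"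

definition smooth_on :: "'a::euclidean_space set \<Rightarrow> ('a \<Rightarrow> 'b::real_normed_vector) \<Rightarrow> bool" where
  "smooth_on S f \<longleftrightarrow> (\<forall>k. Ck_on k S f)"

section \<open>Smooth manifolds\<close>

text \<open>The underlying space of the manifold is the type \<open>'m\<close>, assumed Hausdorff and second countable
  through its type classes. A chart is its domain together with a map to Euclidean space whose
  values outside the domain are irrelevant.\<close>

type_synonym ('m, 'k) chart = "'m set \<times> ('m \<Rightarrow> real ^ 'k)"

definition cinv :: "('m, 'k) chart \<Rightarrow> real ^ 'k \<Rightarrow> 'm" where
  "cinv c = inv_into (fst c) (snd c)"

definition smooth_atlas ::
  "('m::{t2_space, second_countable_topology}, 'k::finite) chart set \<Rightarrow> bool" where
  "smooth_atlas A \<longleftrightarrow>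
     (\<Union>c\<in>A. fst c) = UNIV \<and>
     (\<forall>c\<in>A. open (fst c) \<and> open (snd c ` fst c) \<and>
            homeomorphism (fst c) (snd c ` fst c) (snd c) (cinv c)) \<and>
     (\<forall>c\<in>A. \<forall>d\<in>A. smooth_on (snd c ` (fst c \<inter> fst d)) (snd d \<circ> cinv c))"

definition chart_at :: "('m, 'k) chart set \<Rightarrow> 'm \<Rightarrow> ('m, 'k) chart" where
  "chart_at A p = (SOME c. c \<in> A \<and> p \<in> fst c)"

text \<open>Every tangent space is modelled on \<open>real ^ 'k\<close>: the vector \<open>v\<close> at \<open>p\<close> stands for the tangent
  vector whose components in the chosen chart \<open>chart_at A p\<close> are \<open>v\<close>. Since the chosen chart may
  jump from point to point, smoothness of a vector field is not smoothness of the map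
  \<open>'m \<Rightarrow> real ^ 'k\<close>; it is tested on the components \<open>vf_repr A c X\<close> in each single chart \<open>c\<close>, which
  are obtained from the values of \<open>X\<close> by the Jacobian of the change of charts.\<close>

definition vf_repr ::
  "('m, 'k::finite) chart set \<Rightarrow> ('m, 'k) chart \<Rightarrow> ('m \<Rightarrow> real ^ 'k) \<Rightarrow> real ^ 'k \<Rightarrow> real ^ 'k" where
  "vf_repr A c X u =
     (let p = cinv c u; d = chart_at A p
      in frechet_derivative (snd c \<circ> cinv d) (at (snd d p)) (X p))"

definition smooth_vf ::
  "('m, 'k::finite) chart set \<Rightarrow> 'm set \<Rightarrow> ('m \<Rightarrow> real ^ 'k) \<Rightarrow> bool" where
  "smooth_vf A U X \<longleftrightarrow> (\<forall>c\<in>A. smooth_on (snd c ` (U \<inter> fst c)) (vf_repr A c X))"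

definition smooth_fun :: "('m, 'k::finite) chart set \<Rightarrow> 'm set \<Rightarrow> ('m \<Rightarrow> real) \<Rightarrow> bool" where
  "smooth_fun A U f \<longleftrightarrow> (\<forall>c\<in>A. smooth_on (snd c ` (U \<inter> fst c)) (f \<circ> cinv c))"

text \<open>The derivative \<open>v f\<close> of a function \<open>f\<close> along the tangent vector \<open>v\<close> at \<open>p\<close>.\<close>

definition dir_deriv ::
  "('m, 'k::finite) chart set \<Rightarrow> 'm \<Rightarrow> real ^ 'k \<Rightarrow> ('m \<Rightarrow> real) \<Rightarrow> real" where
  "dir_deriv A p v f =
     frechet_derivative (f \<circ> cinv (chart_at A p)) (at (snd (chart_at A p) p)) v"

section \<open>Riemannian metrics and the Levi-Civita connection\<close>

definition riemannian_metric ::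
  "('m::topological_space, 'k::finite) chart set \<Rightarrow> ('m \<Rightarrow> real ^ 'k \<Rightarrow> real ^ 'k \<Rightarrow> real) \<Rightarrow> bool"
where
  "riemannian_metric A g \<longleftrightarrow>
     (\<forall>p. bilinear (g p) \<and> (\<forall>x y. g p x y = g p y x) \<and> (\<forall>x. x \<noteq> 0 \<longrightarrow> g p x x > 0)) \<and>
     (\<forall>U X Y. open U \<and> smooth_vf A U X \<and> smooth_vf A U Y \<longrightarrow>
        smooth_fun A U (\<lambda>p. g p (X p) (Y p)))"

type_synonym ('m, 'k) connection = "'m \<Rightarrow> real ^ 'k \<Rightarrow> ('m \<Rightarrow> real ^ 'k) \<Rightarrow> real ^ 'k"

text \<open>\<open>D p v Y\<close> is the covariant derivative of \<open>Y\<close> at \<open>p\<close> in the direction \<open>v\<close>. The axioms are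
  imposed on vector fields defined and smooth on arbitrary open sets \<open>U\<close>. \<open>Y\<close> is a total function,
  but its values outside \<open>U\<close> do not influence \<open>D p v Y\<close> for \<open>p \<in> U\<close>: apply the Leibniz rule to the
  indicator function of the complement of \<open>U\<close>.\<close>

definition affine_connection ::
  "('m::topological_space, 'k::finite) chart set
     \<Rightarrow> ('m, 'k) connection \<Rightarrow> bool" where
  "affine_connection A D \<longleftrightarrow>
     (\<forall>U Y. open U \<and> smooth_vf A U Y \<longrightarrow>
        (\<forall>p\<in>U. linear (\<lambda>v. D p v Y)) \<and>
        (\<forall>X. smooth_vf A U X \<longrightarrow> smooth_vf A U (\<lambda>p. D p (X p) Y)) \<and>
        (\<forall>Z. smooth_vf A U Z \<longrightarrow>
           (\<forall>p\<in>U. \<forall>v. D p v (\<lambda>q. Y q + Z q) = D p v Y + D p v Z)) \<and>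
        (\<forall>f. smooth_fun A U f \<longrightarrow>
           (\<forall>p\<in>U. \<forall>v. D p v (\<lambda>q. f q *\<^sub>R Y q) = dir_deriv A p v f *\<^sub>R Y p + f p *\<^sub>R D p v Y)))"

text \<open>\<open>\<nabla>\<^sub>X Y - \<nabla>\<^sub>Y X = [X, Y]\<close>, where \<open>[X, Y]\<close> is characterised by \<open>[X, Y] f = X (Y f) - Y (X f)\<close>.\<close>

definition torsion_free ::
  "('m::topological_space, 'k::finite) chart set
     \<Rightarrow> ('m, 'k) connection \<Rightarrow> bool" where
  "torsion_free A D \<longleftrightarrow>
     (\<forall>U X Y f. open U \<and> smooth_vf A U X \<and> smooth_vf A U Y \<and> smooth_fun A U f \<longrightarrow>
        (\<forall>p\<in>U. dir_deriv A p (D p (X p) Y - D p (Y p) X) f =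
           dir_deriv A p (X p) (\<lambda>q. dir_deriv A q (Y q) f) -
           dir_deriv A p (Y p) (\<lambda>q. dir_deriv A q (X q) f)))"

definition metric_compatible ::
  "('m::topological_space, 'k::finite) chart set \<Rightarrow> ('m \<Rightarrow> real ^ 'k \<Rightarrow> real ^ 'k \<Rightarrow> real)
     \<Rightarrow> ('m, 'k) connection \<Rightarrow> bool" where
  "metric_compatible A g D \<longleftrightarrow>
     (\<forall>U Y Z. open U \<and> smooth_vf A U Y \<and> smooth_vf A U Z \<longrightarrow>
        (\<forall>p\<in>U. \<forall>v. dir_deriv A p v (\<lambda>q. g q (Y q) (Z q)) =
           g p (D p v Y) (Z p) + g p (Y p) (D p v Z)))"

definition levi_civita ::
  "('m::topological_space, 'k::finite) chart set \<Rightarrow> ('m \<Rightarrow> real ^ 'k \<Rightarrow> real ^ 'k \<Rightarrow> real)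
     \<Rightarrow> ('m, 'k) connection \<Rightarrow> bool" where
  "levi_civita A g D \<longleftrightarrow> affine_connection A D \<and> torsion_free A D \<and> metric_compatible A g D"

section \<open>Almost paracontact almost paracomplex Riemannian manifolds\<close>

record ('m, 'k) apapr =
  atlas :: "('m, 'k) chart set"
  phi :: "'m \<Rightarrow> real ^ 'k \<Rightarrow> real ^ 'k"
  xi :: "'m \<Rightarrow> real ^ 'k"
  eta :: "'m \<Rightarrow> real ^ 'k \<Rightarrow> real"
  metr :: "'m \<Rightarrow> real ^ 'k \<Rightarrow> real ^ 'k \<Rightarrow> real"

definition apapr_manifold ::
  "nat \<Rightarrow> ('m::{t2_space, second_countable_topology}, 'k::finite) apapr \<Rightarrow> bool" where
  "apapr_manifold n M \<longleftrightarrow>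
     n \<ge> 1 \<and> CARD('k) = 2 * n + 1 \<and>
     smooth_atlas (atlas M) \<and>
     (\<forall>p. linear (phi M p)) \<and>
     (\<forall>U X. open U \<and> smooth_vf (atlas M) U X \<longrightarrow> smooth_vf (atlas M) U (\<lambda>p. phi M p (X p))) \<and>
     smooth_vf (atlas M) UNIV (xi M) \<and>
     (\<forall>p. linear (eta M p)) \<and>
     (\<forall>U X. open U \<and> smooth_vf (atlas M) U X \<longrightarrow> smooth_fun (atlas M) U (\<lambda>p. eta M p (X p))) \<and>
     riemannian_metric (atlas M) (metr M) \<and>
     (\<forall>p. phi M p (xi M p) = 0 \<and>
          (\<forall>x. phi M p (phi M p x) = x - eta M p x *\<^sub>R xi M p) \<and>
          (\<forall>x. eta M p (phi M p x) = 0) \<and>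
          eta M p (xi M p) = 1 \<and>
          trace (matrix (phi M p)) = 0 \<and>
          (\<forall>x y. metr M p (phi M p x) (phi M p y) = metr M p x y - eta M p x * eta M p y) \<and>
          (\<forall>x. metr M p x (xi M p) = eta M p x))"

section \<open>The fundamental tensor and the Lee forms\<close>

definition local_ext ::
  "('m::topological_space, 'k::finite) chart set \<Rightarrow> 'm \<Rightarrow> real ^ 'k \<Rightarrow> 'm \<Rightarrow> real ^ 'k" where
  "local_ext A p y = (SOME Y. (\<exists>U. open U \<and> p \<in> U \<and> smooth_vf A U Y) \<and> Y p = y)"

text \<open>\<open>(\<nabla>\<^sub>x \<phi>) y = \<nabla>\<^sub>x (\<phi> Y) - \<phi> (\<nabla>\<^sub>x Y)\<close> for a local smooth vector field \<open>Y\<close> with \<open>Y p = y\<close>; the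
  Leibniz rule makes the value independent of the choice of \<open>Y\<close>.\<close>

definition nabla_phi ::
  "('m::topological_space, 'k::finite) apapr \<Rightarrow> ('m, 'k) connection
     \<Rightarrow> 'm \<Rightarrow> real ^ 'k \<Rightarrow> real ^ 'k \<Rightarrow> real ^ 'k" where
  "nabla_phi M D p x y =
     (let Y = local_ext (atlas M) p y in D p x (\<lambda>q. phi M q (Y q)) - phi M p (D p x Y))"

definition fund ::
  "('m::topological_space, 'k::finite) apapr \<Rightarrow> ('m, 'k) connection
     \<Rightarrow> 'm \<Rightarrow> real ^ 'k \<Rightarrow> real ^ 'k \<Rightarrow> real ^ 'k \<Rightarrow> real" where
  "fund M D p x y z = metr M p (nabla_phi M D p x y) z"

definition orthonormal_basis_ker ::
  "('m, 'k::finite) apapr \<Rightarrow> 'm \<Rightarrow> (real ^ 'k) set \<Rightarrow> bool" where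
  "orthonormal_basis_ker M p B \<longleftrightarrow>
     span B = {v. eta M p v = 0} \<and>
     (\<forall>e\<in>B. \<forall>e'\<in>B. metr M p e e' = (if e = e' then 1 else 0))"

text \<open>The Lee forms do not depend on the orthonormal basis, so an arbitrary one is chosen.\<close>

definition ker_basis :: "('m, 'k::finite) apapr \<Rightarrow> 'm \<Rightarrow> (real ^ 'k) set" where
  "ker_basis M p = (SOME B. orthonormal_basis_ker M p B)"

definition lee_theta ::
  "('m::topological_space, 'k::finite) apapr \<Rightarrow> ('m, 'k) connection \<Rightarrow> 'm \<Rightarrow> real ^ 'k \<Rightarrow> real"
where
  "lee_theta M D p z = (\<Sum>e\<in>ker_basis M p. fund M D p e e z)"

definition lee_theta_star ::
  "('m::topological_space, 'k::finite) apapr \<Rightarrow> ('m, 'k) connection \<Rightarrow> 'm \<Rightarrow> real ^ 'k \<Rightarrow> real"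
where
  "lee_theta_star M D p z = (\<Sum>e\<in>ker_basis M p. fund M D p e (phi M p e) z)"

definition lee_omega ::
  "('m::topological_space, 'k::finite) apapr \<Rightarrow> ('m, 'k) connection \<Rightarrow> 'm \<Rightarrow> real ^ 'k \<Rightarrow> real"
where
  "lee_omega M D p z = fund M D p (xi M p) (xi M p) z"

section \<open>The components of the fundamental tensor\<close>

text \<open>\<open>n\<close> is the integer with \<open>dim M = 2 n + 1\<close>; \<open>tens_br\<close> is the bracket \<open>[S]\<close>.\<close>

definition tens_br ::
  "('m, 'k::finite) apapr \<Rightarrow> 'm \<Rightarrow> (real ^ 'k \<Rightarrow> real ^ 'k \<Rightarrow> real)
     \<Rightarrow> real ^ 'k \<Rightarrow> real ^ 'k \<Rightarrow> real ^ 'k \<Rightarrow> real" where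
  "tens_br M p S x y z = S x y * eta M p z + S x z * eta M p y"

definition tens_b ::
  "('m::topological_space, 'k::finite) apapr \<Rightarrow> ('m, 'k) connection
     \<Rightarrow> 'm \<Rightarrow> real ^ 'k \<Rightarrow> real ^ 'k \<Rightarrow> real" where
  "tens_b M D p x y = fund M D p (phi M p (phi M p x)) (phi M p (phi M p y)) (xi M p)"

definition tens_c ::
  "('m::topological_space, 'k::finite) apapr \<Rightarrow> ('m, 'k) connection
     \<Rightarrow> 'm \<Rightarrow> real ^ 'k \<Rightarrow> real ^ 'k \<Rightarrow> real" where
  "tens_c M D p x y = fund M D p (phi M p x) (phi M p y) (xi M p)"

definition F1 ::
  "nat \<Rightarrow> ('m::topological_space, 'k::finite) apapr \<Rightarrow> ('m, 'k) connection
     \<Rightarrow> 'm \<Rightarrow> real ^ 'k \<Rightarrow> real ^ 'k \<Rightarrow> real ^ 'k \<Rightarrow> real" where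
  "F1 n M D p x y z =
     (let g = metr M p; f = phi M p; h = (\<lambda>u. f (f u)); \<theta> = lee_theta M D p in
      1 / (2 * real n) *
        (g (f x) (f y) * \<theta> (h z) + g (f x) (f z) * \<theta> (h y)
         - g x (f y) * \<theta> (f z) - g x (f z) * \<theta> (f y)))"

definition F2 ::
  "nat \<Rightarrow> ('m::topological_space, 'k::finite) apapr \<Rightarrow> ('m, 'k) connection
     \<Rightarrow> 'm \<Rightarrow> real ^ 'k \<Rightarrow> real ^ 'k \<Rightarrow> real ^ 'k \<Rightarrow> real" where
  "F2 n M D p x y z =
     (let F = fund M D p; f = phi M p; h = (\<lambda>u. f (f u)) in
      1 / 4 *
        (2 * F (h x) (h y) (h z) + F (h y) (h z) (h x) + F (h z) (h x) (h y)
         - F (f y) (f z) (h x) - F (f z) (f y) (h x))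
      - F1 n M D p x y z)"

definition F3 ::
  "nat \<Rightarrow> ('m::topological_space, 'k::finite) apapr \<Rightarrow> ('m, 'k) connection
     \<Rightarrow> 'm \<Rightarrow> real ^ 'k \<Rightarrow> real ^ 'k \<Rightarrow> real ^ 'k \<Rightarrow> real" where
  "F3 n M D p x y z =
     (let F = fund M D p; f = phi M p; h = (\<lambda>u. f (f u)) in
      1 / 4 *
        (2 * F (h x) (h y) (h z) - F (h y) (h z) (h x) - F (h z) (h x) (h y)
         + F (f y) (f z) (h x) + F (f z) (f y) (h x)))"

definition F4 ::
  "nat \<Rightarrow> ('m::topological_space, 'k::finite) apapr \<Rightarrow> ('m, 'k) connection
     \<Rightarrow> 'm \<Rightarrow> real ^ 'k \<Rightarrow> real ^ 'k \<Rightarrow> real ^ 'k \<Rightarrow> real" where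
  "F4 n M D p x y z =
     lee_theta M D p (xi M p) / (2 * real n) *
       tens_br M p (\<lambda>x y. metr M p (phi M p x) (phi M p y)) x y z"

definition F5 ::
  "nat \<Rightarrow> ('m::topological_space, 'k::finite) apapr \<Rightarrow> ('m, 'k) connection
     \<Rightarrow> 'm \<Rightarrow> real ^ 'k \<Rightarrow> real ^ 'k \<Rightarrow> real ^ 'k \<Rightarrow> real" where
  "F5 n M D p x y z =
     lee_theta_star M D p (xi M p) / (2 * real n) *
       tens_br M p (\<lambda>x y. metr M p x (phi M p y)) x y z"

definition F6 ::
  "nat \<Rightarrow> ('m::topological_space, 'k::finite) apapr \<Rightarrow> ('m, 'k) connection
     \<Rightarrow> 'm \<Rightarrow> real ^ 'k \<Rightarrow> real ^ 'k \<Rightarrow> real ^ 'k \<Rightarrow> real" where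
  "F6 n M D p x y z =
     (let b = tens_b M D p; c = tens_c M D p in
      1 / 4 * tens_br M p (\<lambda>x y. b x y + b y x + c x y + c y x) x y z
      - F4 n M D p x y z - F5 n M D p x y z)"

definition F7 ::
  "nat \<Rightarrow> ('m::topological_space, 'k::finite) apapr \<Rightarrow> ('m, 'k) connection
     \<Rightarrow> 'm \<Rightarrow> real ^ 'k \<Rightarrow> real ^ 'k \<Rightarrow> real ^ 'k \<Rightarrow> real" where
  "F7 n M D p x y z =
     (let b = tens_b M D p; c = tens_c M D p in
      1 / 4 * tens_br M p (\<lambda>x y. b x y - b y x + c x y - c y x) x y z)"

definition F8 ::
  "nat \<Rightarrow> ('m::topological_space, 'k::finite) apapr \<Rightarrow> ('m, 'k) connection
     \<Rightarrow> 'm \<Rightarrow> real ^ 'k \<Rightarrow> real ^ 'k \<Rightarrow> real ^ 'k \<Rightarrow> real" where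
  "F8 n M D p x y z =
     (let b = tens_b M D p; c = tens_c M D p in
      1 / 4 * tens_br M p (\<lambda>x y. b x y + b y x - c x y - c y x) x y z)"

definition F9 ::
  "nat \<Rightarrow> ('m::topological_space, 'k::finite) apapr \<Rightarrow> ('m, 'k) connection
     \<Rightarrow> 'm \<Rightarrow> real ^ 'k \<Rightarrow> real ^ 'k \<Rightarrow> real ^ 'k \<Rightarrow> real" where
  "F9 n M D p x y z =
     (let b = tens_b M D p; c = tens_c M D p in
      1 / 4 * tens_br M p (\<lambda>x y. b x y - b y x - c x y + c y x) x y z)"

definition F10 ::
  "nat \<Rightarrow> ('m::topological_space, 'k::finite) apapr \<Rightarrow> ('m, 'k) connection
     \<Rightarrow> 'm \<Rightarrow> real ^ 'k \<Rightarrow> real ^ 'k \<Rightarrow> real ^ 'k \<Rightarrow> real" where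
  "F10 n M D p x y z =
     eta M p x * fund M D p (xi M p) (phi M p (phi M p y)) (phi M p (phi M p z))"

definition F11 ::
  "nat \<Rightarrow> ('m::topological_space, 'k::finite) apapr \<Rightarrow> ('m, 'k) connection
     \<Rightarrow> 'm \<Rightarrow> real ^ 'k \<Rightarrow> real ^ 'k \<Rightarrow> real ^ 'k \<Rightarrow> real" where
  "F11 n M D p x y z =
     eta M p x * (eta M p y * lee_omega M D p z + eta M p z * lee_omega M D p y)"

text \<open>\<open>in_class n M D I\<close>: \<open>M\<close> belongs to the direct sum of the basic classes with indices in \<open>I\<close>.\<close>

definition fund_comp ::
  "nat \<Rightarrow> ('m::topological_space, 'k::finite) apapr \<Rightarrow> ('m, 'k) connection \<Rightarrow> nat
     \<Rightarrow> 'm \<Rightarrow> real ^ 'k \<Rightarrow> real ^ 'k \<Rightarrow> real ^ 'k \<Rightarrow> real" where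
  "fund_comp n M D i =
     [F1 n M D, F2 n M D, F3 n M D, F4 n M D, F5 n M D, F6 n M D,
      F7 n M D, F8 n M D, F9 n M D, F10 n M D, F11 n M D] ! (i - 1)"

definition in_class ::
  "nat \<Rightarrow> ('m::topological_space, 'k::finite) apapr \<Rightarrow> ('m, 'k) connection \<Rightarrow> nat set \<Rightarrow> bool" where
  "in_class n M D I \<longleftrightarrow>
     (\<forall>p x y z. fund M D p x y z = (\<Sum>i\<in>I. fund_comp n M D i p x y z))"

end

theory Submission
  imports Defs
begin

text \<open>
  Everything reduces to one tangent space. There \<open>\<phi>\<close> is self-adjoint with \<open>\<phi>\<^sup>2 = 1\<close> on the plane
  \<open>ker \<eta>\<close>, and \<open>tr \<phi> = 0\<close> forces both eigenvalues \<open>1\<close> and \<open>-1\<close> to occur. In dimension 3 this gives an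
  orthonormal frame \<open>\<xi>, e\<^sub>1, e\<^sub>2\<close> with \<open>\<phi> e\<^sub>1 = e\<^sub>1\<close> and \<open>\<phi> e\<^sub>2 = - e\<^sub>2\<close> (\<open>eigenframe\<close>).

  The fundamental tensor satisfies two identities, \<open>F(x,y,z) = F(x,z,y)\<close> and
  \<open>F(x,\<phi>y,\<phi>z) = - F(x,y,z) + \<eta>(y) F(x,\<xi>,z) + \<eta>(z) F(x,y,\<xi>)\<close>. They kill \<open>F(x,\<xi>,\<xi>)\<close> and also
  \<open>F(x,e\<^sub>i,e\<^sub>i)\<close>, because the two arguments lie in the same eigenspace. Only \<open>F(x,e\<^sub>1,e\<^sub>2)\<close>,
  \<open>F(x,e\<^sub>1,\<xi>)\<close> and \<open>F(x,e\<^sub>2,\<xi>)\<close> survive, each linear in \<open>x\<close>: nine numbers determine \<open>F\<close>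
  (\<open>F_eigenframe\<close>). The seven components account for exactly these nine:
  \<open>F\<^sub>1\<close> carries \<open>F(e\<^sub>i,e\<^sub>1,e\<^sub>2)\<close>, \<open>F\<^sub>1\<^sub>0\<close> carries \<open>F(\<xi>,e\<^sub>1,e\<^sub>2)\<close>, \<open>F\<^sub>1\<^sub>1\<close> carries \<open>F(\<xi>,e\<^sub>i,\<xi>)\<close>,
  \<open>F\<^sub>4 + F\<^sub>5\<close> the diagonal and \<open>F\<^sub>8 + F\<^sub>9\<close> the off-diagonal entries of the matrix \<open>F(e\<^sub>i,e\<^sub>j,\<xi>)\<close>.

  The link with the manifold is that \<open>F\<close>, defined by an arbitrary smooth extension of \<open>y\<close>, is trilinear
  and obeys the two identities. Differentiating \<open>g(\<phi>Y,Z) = g(Y,\<phi>Z)\<close> shows that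
  \<open>N Y = \<nabla>\<^sub>x(\<phi>Y) - \<phi>(\<nabla>\<^sub>xY)\<close> satisfies \<open>g(N Y,Z) = g(Y,N Z)\<close> at the point
  (\<open>nabla_phi_field_self_adjoint\<close>). The right-hand side sees only the value
  of \<open>Y\<close> at the point, so independence of the extension, symmetry, and linearity in \<open>y\<close> all follow
  without a local frame. Differentiating \<open>\<phi>\<^sup>2Y = Y - \<eta>(Y)\<xi>\<close> gives the other identity. Smooth extensions
  exist because a vector field with constant components in one chart is smooth in all others, which
  rests on closure of \<open>C\<^sup>k\<close> maps under products and composition.
\<close>

section \<open>Closure properties of differentiability classes\<close>

lemma Ck_on_subset: "Ck_on k S f \<Longrightarrow> T \<subseteq> S \<Longrightarrow> Ck_on k T f"
  by (induction k arbitrary: f) (auto intro: continuous_on_subset)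

text \<open>Two functions that coincide on a set have equal derivatives at its interior points only, whence the
  open domain here and below.\<close>

lemma Ck_on_cong:
  assumes "open S" "Ck_on k S f" "\<And>x. x \<in> S \<Longrightarrow> f x = g x"
  shows "Ck_on k S g"
  using assms(2,3)
proof (induction k arbitrary: f g)
  case 0
  then show ?case by (auto cong: continuous_on_cong)
next
  case (Suc k)
  have diff: "f differentiable (at x)" if "x \<in> S" for x using Suc.prems that by simp
  have "g differentiable (at x)" if x: "x \<in> S" for x
  proof -
    obtain f' where "(f has_derivative f') (at x)"
      using diff[OF x] unfolding differentiable_def by blast
    from has_derivative_transform_within_open[OF this assms(1) x Suc.prems(2)]
    show ?thesis unfolding differentiable_def by blast
  qed
  moreover have "Ck_on k S (\<lambda>x. frechet_derivative g (at x) v)" for v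
  proof (rule Suc.IH)
    show "Ck_on k S (\<lambda>x. frechet_derivative f (at x) v)" using Suc.prems by simp
    show "frechet_derivative f (at x) v = frechet_derivative g (at x) v" if "x \<in> S" for x
      using frechet_derivative_transform_within_open[OF diff[OF that] assms(1) that Suc.prems(2)]
      by simp
  qed
  ultimately show ?case by simp
qed

lemma Ck_on_SucD: "Ck_on (Suc k) S f \<Longrightarrow> Ck_on k S f"
proof (induction k arbitrary: f)
  case 0
  then show ?case
    by (auto intro!: continuous_at_imp_continuous_on differentiable_imp_continuous_within)
next
  case (Suc k)
  then show ?case by simp
qed

lemma Ck_on_const: "Ck_on k S (\<lambda>x. c)"
  by (induction k arbitrary: c) auto

lemma Ck_on_add:
  assumes "open S" "Ck_on k S f" "Ck_on k S g"
  shows "Ck_on k S (\<lambda>x. f x + g x)"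
  using assms(2,3)
proof (induction k arbitrary: f g)
  case 0
  then show ?case by (auto intro: continuous_on_add)
next
  case (Suc k)
  have "Ck_on k S (\<lambda>x. frechet_derivative (\<lambda>x. f x + g x) (at x) v)" for v
  proof (rule Ck_on_cong[OF assms(1)])
    show "Ck_on k S (\<lambda>x. frechet_derivative f (at x) v + frechet_derivative g (at x) v)"
      using Suc by simp
    show "frechet_derivative f (at x) v + frechet_derivative g (at x) v =
        frechet_derivative (\<lambda>x. f x + g x) (at x) v" if "x \<in> S" for x
      using Suc.prems that
      by (subst frechet_derivative_at[OF has_derivative_add, symmetric, of f "frechet_derivative f (at x)"])
         (auto simp: frechet_derivative_works)
  qed
  then show ?case using Suc.prems by auto
qed

lemma Ck_on_sum:
  assumes "open S" "finite I" "\<And>i. i \<in> I \<Longrightarrow> Ck_on k S (f i)"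
  shows "Ck_on k S (\<lambda>x. \<Sum>i\<in>I. f i x)"
  using assms(2,3) by (induction I rule: finite_induct) (auto intro: Ck_on_const Ck_on_add[OF assms(1)])

lemma Ck_on_bounded_linear:
  assumes "bounded_linear L" "open S" "Ck_on k S f"
  shows "Ck_on k S (\<lambda>x. L (f x))"
  using assms(3)
proof (induction k arbitrary: f)
  case 0
  then show ?case by (auto intro: bounded_linear.continuous_on[OF assms(1)])
next
  case (Suc k)
  have der: "((\<lambda>x. L (f x)) has_derivative (\<lambda>v. L (frechet_derivative f (at x) v))) (at x)"
    if "x \<in> S" for x
    using Suc.prems that
    by (intro bounded_linear.has_derivative[OF assms(1)]) (simp add: frechet_derivative_works)
  have "Ck_on k S (\<lambda>x. frechet_derivative (\<lambda>x. L (f x)) (at x) v)" for v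
  proof (rule Ck_on_cong[OF assms(2)])
    show "Ck_on k S (\<lambda>x. L (frechet_derivative f (at x) v))"
      using Suc by simp
  qed (simp add: frechet_derivative_at[OF der, symmetric])
  moreover have "\<forall>x\<in>S. (\<lambda>x. L (f x)) differentiable (at x)"
    using der unfolding differentiable_def by blast
  ultimately show ?case by simp
qed

text \<open>By the product rule the derivative is a sum of two products of the same kind with one factor
  differentiated, so the induction runs over all pairs of functions at once.\<close>

lemma Ck_on_scaleR:
  fixes f :: "'a::euclidean_space \<Rightarrow> real" and g :: "'a \<Rightarrow> 'b::real_normed_vector"
  assumes "open S" "Ck_on k S f" "Ck_on k S g"
  shows "Ck_on k S (\<lambda>x. f x *\<^sub>R g x)"
  using assms(2,3)
proof (induction k arbitrary: f g)
  case 0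
  then show ?case by (auto intro: continuous_on_scaleR)
next
  case (Suc k)
  have der: "((\<lambda>x. f x *\<^sub>R g x) has_derivative
      (\<lambda>v. f x *\<^sub>R frechet_derivative g (at x) v + frechet_derivative f (at x) v *\<^sub>R g x)) (at x)"
    if "x \<in> S" for x
    using Suc.prems that by (intro has_derivative_scaleR) (auto simp: frechet_derivative_works)
  have "Ck_on k S (\<lambda>x. frechet_derivative (\<lambda>x. f x *\<^sub>R g x) (at x) v)" for v
  proof (rule Ck_on_cong[OF assms(1)])
    show "Ck_on k S (\<lambda>x. f x *\<^sub>R frechet_derivative g (at x) v + frechet_derivative f (at x) v *\<^sub>R g x)"
      using Suc.prems Ck_on_SucD[OF Suc.prems(1)] Ck_on_SucD[OF Suc.prems(2)]
      by (intro Ck_on_add[OF assms(1)] Suc.IH) auto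
  qed (simp add: frechet_derivative_at[OF der, symmetric])
  moreover have "\<forall>x\<in>S. (\<lambda>x. f x *\<^sub>R g x) differentiable (at x)"
    using der unfolding differentiable_def by blast
  ultimately show ?case by simp
qed

text \<open>The chain rule gives \<open>g'(f x) (f' x v)\<close>, in which the base point and the direction both vary with \<open>x\<close>,
  while \<open>Ck_on\<close> speaks of derivatives in fixed directions. Expanding \<open>f' x v\<close> in the standard basis
  turns this into a finite sum of products of \<open>C\<^sup>k\<close> functions, to which the induction hypothesis applies.\<close>

lemma Ck_on_compose:
  fixes f :: "'a::euclidean_space \<Rightarrow> 'b::euclidean_space" and g :: "'b \<Rightarrow> 'c::real_normed_vector"
  assumes "open S" "f ` S \<subseteq> T" "Ck_on k S f" "Ck_on k T g"
  shows "Ck_on k S (\<lambda>x. g (f x))"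
  using assms(3,4)
proof (induction k arbitrary: g)
  case 0
  then have "continuous_on S f" "continuous_on T g" by simp_all
  then show ?case using continuous_on_compose2[OF _ _ assms(2)] by auto
next
  case (Suc k)
  have der: "((\<lambda>x. g (f x)) has_derivative
      (\<lambda>v. frechet_derivative g (at (f x)) (frechet_derivative f (at x) v))) (at x)"
    if "x \<in> S" for x
  proof -
    have "f differentiable (at x)" "g differentiable (at (f x))"
      using Suc.prems that assms(2) by auto
    then have "(f has_derivative frechet_derivative f (at x)) (at x)"
      "(g has_derivative frechet_derivative g (at (f x))) (at (f x))"
      by (simp_all only: frechet_derivative_works)
    then show ?thesis by (rule has_derivative_compose)
  qed
  have "Ck_on k S (\<lambda>x. frechet_derivative (\<lambda>x. g (f x)) (at x) v)" for v
  proof (rule Ck_on_cong[OF assms(1)])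
    show "Ck_on k S (\<lambda>x. \<Sum>b\<in>Basis.
        (frechet_derivative f (at x) v \<bullet> b) *\<^sub>R frechet_derivative g (at (f x)) b)"
      using Suc.prems Ck_on_SucD[OF Suc.prems(1)]
      by (intro Ck_on_sum Ck_on_scaleR assms(1) finite_Basis Suc.IH
            Ck_on_bounded_linear[OF bounded_linear_inner_left]) auto
    show "(\<Sum>b\<in>Basis. (frechet_derivative f (at x) v \<bullet> b) *\<^sub>R frechet_derivative g (at (f x)) b)
        = frechet_derivative (\<lambda>x. g (f x)) (at x) v" if "x \<in> S" for x
    proof -
      have lin: "linear (frechet_derivative g (at (f x)))"
        using Suc.prems(2) that assms(2) by (auto intro!: linear_frechet_derivative)
      have "(\<Sum>b\<in>Basis. (frechet_derivative f (at x) v \<bullet> b) *\<^sub>R frechet_derivative g (at (f x)) b)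
          = frechet_derivative g (at (f x)) (\<Sum>b\<in>Basis. (frechet_derivative f (at x) v \<bullet> b) *\<^sub>R b)"
        by (simp add: linear_sum[OF lin] linear_cmul[OF lin])
      then show ?thesis
        by (simp add: euclidean_representation frechet_derivative_at[OF der[OF that], symmetric])
    qed
  qed
  moreover have "\<forall>x\<in>S. (\<lambda>x. g (f x)) differentiable (at x)"
    using der unfolding differentiable_def by blast
  ultimately show ?case by simp
qed

section \<open>Orthonormal sets for an arbitrary inner product\<close>

locale inner_form =
  fixes g :: "'a::euclidean_space \<Rightarrow> 'a \<Rightarrow> real"
  assumes bil: "bilinear g" and g_sym: "g x y = g y x" and g_pos: "x \<noteq> 0 \<Longrightarrow> g x x > 0"
begin

lemmas g_simps = bilinear_ladd[OF bil] bilinear_radd[OF bil] bilinear_lmul[OF bil]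
  bilinear_rmul[OF bil] bilinear_lsub[OF bil] bilinear_rsub[OF bil] bilinear_lneg[OF bil]
  bilinear_rneg[OF bil] bilinear_lzero[OF bil] bilinear_rzero[OF bil]

lemma g_sum_left: "g (\<Sum>i\<in>I. h i) y = (\<Sum>i\<in>I. g (h i) y)"
  using bil linear_sum unfolding bilinear_def by blast

lemma eq_if_g_eq:
  assumes "\<And>z. g x z = g y z"
  shows "x = y"
  using g_pos[of "x - y"] assms by (force simp: g_simps)

lemma orthonormal_finite_independent:
  assumes "\<And>e e'. e \<in> B \<Longrightarrow> e' \<in> B \<Longrightarrow> g e e' = (if e = e' then 1 else 0)"
  shows "independent B" "finite B"
proof -
  show "independent B"
    unfolding independent_explicit_module
  proof (intro allI impI)
    fix t u v assume t: "finite t" "t \<subseteq> B" and s: "(\<Sum>v\<in>t. u v *\<^sub>R v) = 0" and v: "v \<in> t"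
    have "0 = g (\<Sum>v\<in>t. u v *\<^sub>R v) v" using s by (simp add: g_simps)
    also have "\<dots> = (\<Sum>w\<in>t. if w = v then u w else 0)"
      unfolding g_sum_left using t v by (intro sum.cong) (auto simp: g_simps assms subset_iff)
    also have "\<dots> = u v" using t v by simp
    finally show "u v = 0" by simp
  qed
  then show "finite B" by (rule independent_imp_finite)
qed

lemma orthonormal_expansion:
  assumes "\<And>e e'. e \<in> B \<Longrightarrow> e' \<in> B \<Longrightarrow> g e e' = (if e = e' then 1 else 0)" "x \<in> span B"
  shows "(\<Sum>e\<in>B. g x e *\<^sub>R e) = x"
proof -
  have fin: "finite B" using orthonormal_finite_independent[OF assms(1)] by blast
  obtain u where u: "x = (\<Sum>v\<in>B. u v *\<^sub>R v)"
    using assms(2) unfolding span_finite[OF fin] by blast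
  have "g x e = u e" if "e \<in> B" for e
  proof -
    have "g x e = (\<Sum>w\<in>B. if w = e then u w else 0)"
      unfolding u g_sum_left using that by (intro sum.cong) (auto simp: g_simps assms(1))
    then show ?thesis using that fin by simp
  qed
  then show ?thesis unfolding u by simp
qed

text \<open>Expanding each element of \<open>B\<close> in \<open>C\<close> produces the matrix with entries \<open>g e i\<close>. It is orthogonal because
  both sets span the same space, so the trace of \<open>T\<close> is unchanged. This makes the Lee forms computable
  in a frame adapted to the structure.\<close>

lemma orthonormal_sum_unique:
  assumes B: "\<And>e e'. e \<in> B \<Longrightarrow> e' \<in> B \<Longrightarrow> g e e' = (if e = e' then 1 else 0)"
    and C: "\<And>e e'. e \<in> C \<Longrightarrow> e' \<in> C \<Longrightarrow> g e e' = (if e = e' then 1 else 0)"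
    and span: "span B = span C" and T: "bilinear T"
  shows "(\<Sum>e\<in>B. T e e) = (\<Sum>e\<in>C. T e e :: real)"
proof -
  have finB: "finite B" and finC: "finite C"
    using orthonormal_finite_independent B C by blast+
  have "T e e = (\<Sum>i\<in>C. \<Sum>j\<in>C. g e i * g e j * T i j)" if "e \<in> B" for e
  proof -
    have e: "e = (\<Sum>i\<in>C. g e i *\<^sub>R i)"
      using orthonormal_expansion[OF C] span span_base[OF that] by metis
    have "T e e = T (\<Sum>i\<in>C. g e i *\<^sub>R i) (\<Sum>i\<in>C. g e i *\<^sub>R i)" using e by simp
    also have "\<dots> = (\<Sum>(i, j)\<in>C \<times> C. T (g e i *\<^sub>R i) (g e j *\<^sub>R j))"
      by (rule bilinear_sum[OF T])
    also have "\<dots> = (\<Sum>i\<in>C. \<Sum>j\<in>C. g e i * g e j * T i j)"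
      by (simp add: sum.cartesian_product bilinear_lmul[OF T] bilinear_rmul[OF T] mult.assoc mult.left_commute)
    finally show ?thesis .
  qed
  then have "(\<Sum>e\<in>B. T e e) = (\<Sum>e\<in>B. \<Sum>i\<in>C. \<Sum>j\<in>C. g e i * g e j * T i j)" by simp
  also have "\<dots> = (\<Sum>i\<in>C. \<Sum>j\<in>C. \<Sum>e\<in>B. g e i * g e j * T i j)"
    by (simp add: sum.swap[of _ C B])
  also have "\<dots> = (\<Sum>i\<in>C. \<Sum>j\<in>C. (if i = j then T i j else 0))"
  proof (intro sum.cong refl)
    fix i j assume ij: "i \<in> C" "j \<in> C"
    have "(\<Sum>e\<in>B. g e i * g e j) = g (\<Sum>e\<in>B. g i e *\<^sub>R e) j"
      unfolding g_sum_left by (simp add: g_simps g_sym)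
    also have "(\<Sum>e\<in>B. g i e *\<^sub>R e) = i"
      using orthonormal_expansion[OF B] span span_base[OF ij(1)] by blast
    finally show "(\<Sum>e\<in>B. g e i * g e j * T i j) = (if i = j then T i j else 0)"
      using C[OF ij] by (simp add: sum_distrib_right[symmetric])
  qed
  also have "\<dots> = (\<Sum>e\<in>C. T e e)"
    using finC by simp
  finally show ?thesis .
qed

end

section \<open>The structure on one tangent space\<close>

locale apapr_space = inner_form g for g :: "real ^ 'k::finite \<Rightarrow> real ^ 'k \<Rightarrow> real" +
  fixes f :: "real ^ 'k \<Rightarrow> real ^ 'k" and \<xi> :: "real ^ 'k" and \<eta> :: "real ^ 'k \<Rightarrow> real"
  assumes lin_f: "linear f" and lin_eta: "linear \<eta>"
    and f_xi: "f \<xi> = 0" and f_f: "f (f x) = x - \<eta> x *\<^sub>R \<xi>" and eta_f: "\<eta> (f x) = 0"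
    and eta_xi: "\<eta> \<xi> = 1" and tr_f: "trace (matrix f) = 0"
    and g_f_f: "g (f x) (f y) = g x y - \<eta> x * \<eta> y" and g_xi: "g x \<xi> = \<eta> x"
begin

lemma f_self_adjoint: "g (f x) y = g x (f y)"
  using g_f_f[of x "f y"] g_xi[of "f x"] by (simp add: f_f eta_f g_simps)

lemma g_xi_left: "g \<xi> x = \<eta> x"
  using g_sym g_xi by metis

text \<open>On \<open>ker \<eta>\<close> the map is \<open>s\<close> times the identity, and it kills \<open>\<xi>\<close>.\<close>

lemma trace_scaled_projection: "trace (matrix (\<lambda>x. s *\<^sub>R (x - \<eta> x *\<^sub>R \<xi>))) = s * (of_nat CARD('k) - 1)"
proof -
  have "trace (matrix (\<lambda>x. s *\<^sub>R (x - \<eta> x *\<^sub>R \<xi>))) = (\<Sum>i\<in>UNIV. s * (1 - \<eta> (axis i 1) * \<xi> $ i))"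
    by (simp add: trace_def matrix_def axis_def)
  also have "\<dots> = s * (of_nat CARD('k) - (\<Sum>i\<in>UNIV. \<eta> ((\<xi> $ i) *s axis i 1)))"
    by (simp add: sum_distrib_left[symmetric] sum_subtractf linear_cmul[OF lin_eta]
        scalar_mult_eq_scaleR mult.commute)
  also have "(\<Sum>i\<in>UNIV. \<eta> ((\<xi> $ i) *s axis i 1)) = 1"
    by (simp add: linear_sum[OF lin_eta, symmetric] basis_expansion eta_xi)
  finally show ?thesis .
qed

text \<open>Since \<open>\<phi>\<^sup>3 = \<phi>\<close>, every vector \<open>\<phi>\<^sup>2x + s \<phi>x\<close> satisfies the eigenvalue equation. If all of them vanished,
  \<open>\<phi>\<close> would be \<open>-s\<close> times the projection onto \<open>ker \<eta>\<close>, whose trace vanishes only in dimension 1.\<close>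

lemma unit_eigenvector:
  assumes "CARD('k) \<noteq> 1" "s = 1 \<or> s = -1"
  shows "\<exists>e. f e = s *\<^sub>R e \<and> g e e = 1"
proof -
  have "\<exists>x. f (f x) + s *\<^sub>R f x \<noteq> 0"
  proof (rule ccontr)
    assume "\<not> ?thesis"
    then have "f (f x) + s *\<^sub>R f x = 0" for x by blast
    then have "f x = (- s) *\<^sub>R f (f x)" for x
      using assms(2) add.inverse_unique[of "f (f x)" "s *\<^sub>R f x"] by auto
    then have "f x = (- s) *\<^sub>R (x - \<eta> x *\<^sub>R \<xi>)" for x
      unfolding f_f[symmetric] .
    then have "f = (\<lambda>x. (- s) *\<^sub>R (x - \<eta> x *\<^sub>R \<xi>))" by blast
    then show False
      using tr_f trace_scaled_projection[of "- s"] assms by auto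
  qed
  then obtain x where x: "f (f x) + s *\<^sub>R f x \<noteq> 0" by blast
  define v where "v = f (f x) + s *\<^sub>R f x"
  have fv: "f v = s *\<^sub>R v"
    using assms(2) by (auto simp: v_def linear_add[OF lin_f] linear_cmul[OF lin_f] f_f[of "f x"] eta_f
        linear_neg[OF lin_f])
  have "g v v > 0" using x g_pos by (simp add: v_def)
  then have "g ((1 / sqrt (g v v)) *\<^sub>R v) ((1 / sqrt (g v v)) *\<^sub>R v) = 1"
    by (simp add: g_simps)
  moreover have "f ((1 / sqrt (g v v)) *\<^sub>R v) = s *\<^sub>R ((1 / sqrt (g v v)) *\<^sub>R v)"
    by (simp add: linear_cmul[OF lin_f] fv)
  ultimately show ?thesis by blast
qed

lemma eta_eigenvector: "f e = s *\<^sub>R e \<Longrightarrow> s \<noteq> 0 \<Longrightarrow> \<eta> e = 0"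
  using eta_f[of e] by (simp add: linear_cmul[OF lin_eta])

text \<open>A unit eigenvector for each sign, together with \<open>\<xi>\<close>, is an orthonormal triple: eigenvectors of a
  self-adjoint map with different eigenvalues are orthogonal.\<close>

lemma eigenframe:
  assumes "CARD('k) = 3"
  obtains e1 e2 where "f e1 = e1" "f e2 = - e2" "g e1 e1 = 1" "g e2 e2 = 1" "g e1 e2 = 0"
    "\<eta> e1 = 0" "\<eta> e2 = 0" "\<And>x. x = \<eta> x *\<^sub>R \<xi> + g x e1 *\<^sub>R e1 + g x e2 *\<^sub>R e2"
proof -
  obtain e1 where e1: "f e1 = e1" "g e1 e1 = 1"
    using unit_eigenvector[of 1] assms by auto
  obtain e2 where e2: "f e2 = - e2" "g e2 e2 = 1"
    using unit_eigenvector[of "-1"] assms by auto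
  have eta: "\<eta> e1 = 0" "\<eta> e2 = 0"
    using eta_eigenvector[of e1 1] eta_eigenvector[of e2 "-1"] e1 e2 by auto
  have g12: "g e1 e2 = 0"
    using f_self_adjoint[of e1 e2] by (simp add: e1 e2 g_simps)
  define B where "B = {\<xi>, e1, e2}"
  have ne: "e1 \<noteq> e2" "\<xi> \<noteq> e1" "\<xi> \<noteq> e2" using g12 e1 e2 eta eta_xi by auto
  have B: "g e e' = (if e = e' then 1 else 0)" if "e \<in> B" "e' \<in> B" for e e'
    using that e1(2) e2(2) eta g12 g_sym[of \<xi>] g_sym[of e2 e1] ne
    unfolding B_def by (auto simp: g_xi eta_xi)
  have "independent B" by (rule orthonormal_finite_independent[OF B])
  moreover have "card B = 3" using ne by (simp add: B_def)
  ultimately have "span B = UNIV"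
    using card_ge_dim_independent[of B UNIV] assms by (auto simp: dim_UNIV)
  then have "(\<Sum>e\<in>B. g x e *\<^sub>R e) = x" for x
    using orthonormal_expansion[OF B] by blast
  then have "x = \<eta> x *\<^sub>R \<xi> + g x e1 *\<^sub>R e1 + g x e2 *\<^sub>R e2" for x
    using ne by (simp add: B_def g_xi add.assoc)
  then show ?thesis using that e1 e2 g12 eta by blast
qed

lemma span_eigenframe:
  assumes "\<eta> e1 = 0" "\<eta> e2 = 0" "\<And>x. x = \<eta> x *\<^sub>R \<xi> + g x e1 *\<^sub>R e1 + g x e2 *\<^sub>R e2"
  shows "span {e1, e2} = {v. \<eta> v = 0}"
proof
  show "span {e1, e2} \<subseteq> {v. \<eta> v = 0}"
    using assms(1,2) linear_subspace_kernel[OF lin_eta] by (intro span_minimal) auto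
  show "{v. \<eta> v = 0} \<subseteq> span {e1, e2}"
  proof
    fix v assume "v \<in> {v. \<eta> v = 0}"
    then have "v = g v e1 *\<^sub>R e1 + g v e2 *\<^sub>R e2" using assms(3)[of v] by simp
    then show "v \<in> span {e1, e2}"
      by (metis insertI1 insertI2 span_add span_base span_mul)
  qed
qed

end

section \<open>Tensors with the symmetries of the fundamental tensor\<close>

locale fundamental_form = apapr_space g f \<xi> \<eta>
  for g :: "real ^ 'k::finite \<Rightarrow> real ^ 'k \<Rightarrow> real" and f \<xi> \<eta> +
  fixes F :: "real ^ 'k \<Rightarrow> real ^ 'k \<Rightarrow> real ^ 'k \<Rightarrow> real"
  assumes lin_F1: "linear (\<lambda>x. F x y z)" and lin_F2: "linear (\<lambda>y. F x y z)"
    and lin_F3: "linear (\<lambda>z. F x y z)"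
    and F_sym: "F x y z = F x z y"
    and F_f_f: "F x (f y) (f z) = - F x y z + \<eta> y * F x \<xi> z + \<eta> z * F x y \<xi>"
begin

lemmas F_simps =
  linear_add[OF lin_F1] linear_cmul[OF lin_F1] linear_neg[OF lin_F1] linear_0[OF lin_F1]
  linear_add[OF lin_F2] linear_cmul[OF lin_F2] linear_neg[OF lin_F2] linear_0[OF lin_F2]
  linear_add[OF lin_F3] linear_cmul[OF lin_F3] linear_neg[OF lin_F3] linear_0[OF lin_F3]

lemma F_xi_xi: "F x \<xi> \<xi> = 0"
  using F_f_f[of x \<xi> \<xi>] by (simp add: f_xi eta_xi F_simps)

text \<open>For \<open>y\<close> and \<open>z\<close> in the same eigenspace the left side of \<open>F_f_f\<close> is \<open>F x y z\<close> and the right side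
  is its negative.\<close>

lemma F_same_eigenvalue:
  assumes "f y = s *\<^sub>R y" "f z = s *\<^sub>R z" "s = 1 \<or> s = -1"
  shows "F x y z = 0"
  using F_f_f[of x y z] assms eta_eigenvector[of y s] eta_eigenvector[of z s]
  by (auto simp: F_simps)

lemma F_eigenframe:
  assumes e: "f e1 = e1" "f e2 = - e2" "\<And>x. x = \<eta> x *\<^sub>R \<xi> + g x e1 *\<^sub>R e1 + g x e2 *\<^sub>R e2"
  shows "F x y z =
      (\<eta> x * F \<xi> e1 e2 + g x e1 * F e1 e1 e2 + g x e2 * F e2 e1 e2)
        * (g y e1 * g z e2 + g y e2 * g z e1) +
      (\<eta> x * F \<xi> e1 \<xi> + g x e1 * F e1 e1 \<xi> + g x e2 * F e2 e1 \<xi>)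
        * (g y e1 * \<eta> z + \<eta> y * g z e1) +
      (\<eta> x * F \<xi> e2 \<xi> + g x e1 * F e1 e2 \<xi> + g x e2 * F e2 e2 \<xi>)
        * (g y e2 * \<eta> z + \<eta> y * g z e2)"
proof -
  have z: "F w e1 e1 = 0" "F w e2 e2 = 0" for w
    using F_same_eigenvalue[of e1 1 e1] F_same_eigenvalue[of e2 "-1" e2] e by auto
  have s: "F w e2 e1 = F w e1 e2" "F w \<xi> e1 = F w e1 \<xi>" "F w \<xi> e2 = F w e2 \<xi>" for w
    using F_sym by blast+
  have "F x y z = F (\<eta> x *\<^sub>R \<xi> + g x e1 *\<^sub>R e1 + g x e2 *\<^sub>R e2)
      (\<eta> y *\<^sub>R \<xi> + g y e1 *\<^sub>R e1 + g y e2 *\<^sub>R e2) (\<eta> z *\<^sub>R \<xi> + g z e1 *\<^sub>R e1 + g z e2 *\<^sub>R e2)"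
    using e(3)[of x] e(3)[of y] e(3)[of z] by simp
  then show ?thesis
    by (simp only: F_simps z s F_xi_xi) (simp add: algebra_simps)
qed

end

section \<open>Smooth vector fields and local extensions\<close>

lemma smooth_vf_subset:
  assumes "smooth_vf A U X" "V \<subseteq> U"
  shows "smooth_vf A V X"
  unfolding smooth_vf_def smooth_on_def
proof (intro ballI allI)
  fix c k assume "c \<in> A"
  then have "Ck_on k (snd c ` (U \<inter> fst c)) (vf_repr A c X)"
    using assms(1) by (simp add: smooth_vf_def smooth_on_def)
  then show "Ck_on k (snd c ` (V \<inter> fst c)) (vf_repr A c X)"
    by (rule Ck_on_subset) (use assms(2) in auto)
qed

lemma chart_at:
  assumes "smooth_atlas A"
  shows "chart_at A p \<in> A" "p \<in> fst (chart_at A p)"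
proof -
  have "\<exists>c. c \<in> A \<and> p \<in> fst c" using assms unfolding smooth_atlas_def by blast
  then have "chart_at A p \<in> A \<and> p \<in> fst (chart_at A p)"
    unfolding chart_at_def by (rule someI_ex)
  then show "chart_at A p \<in> A" "p \<in> fst (chart_at A p)" by auto
qed

lemma cinv_chart:
  assumes "smooth_atlas A" "c \<in> A" "q \<in> fst c"
  shows "cinv c (snd c q) = q"
proof -
  have "homeomorphism (fst c) (snd c ` fst c) (snd c) (cinv c)"
    using assms(1,2) by (simp add: smooth_atlas_def)
  then show ?thesis using homeomorphism_apply1 assms(3) by blast
qed

lemma open_chart_image:
  assumes "smooth_atlas A" "c \<in> A" "open U"
  shows "open (snd c ` (U \<inter> fst c))"
proof -
  have c: "open (fst c)" "open (snd c ` fst c)" "homeomorphism (fst c) (snd c ` fst c) (snd c) (cinv c)"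
    using assms unfolding smooth_atlas_def by auto
  have "openin (top_of_set (fst c)) (U \<inter> fst c)"
    using assms c by (auto simp: openin_open_eq)
  from homeomorphism_imp_open_map[OF c(3) this] show ?thesis
    using c(2) openin_open_trans by blast
qed

lemma smooth_transition:
  "smooth_atlas A \<Longrightarrow> c \<in> A \<Longrightarrow> d \<in> A \<Longrightarrow> smooth_on (snd c ` (fst c \<inter> fst d)) (snd d \<circ> cinv c)"
  by (simp add: smooth_atlas_def)

lemma transition_differentiable:
  assumes "smooth_atlas A" "c \<in> A" "d \<in> A" "q \<in> fst c" "q \<in> fst d"
  shows "(snd d \<circ> cinv c) differentiable (at (snd c q))"
proof -
  have "Ck_on (Suc 0) (snd c ` (fst c \<inter> fst d)) (snd d \<circ> cinv c)"
    using smooth_transition[OF assms(1-3)] unfolding smooth_on_def by blast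
  then show ?thesis using assms(4,5) by simp
qed

text \<open>The chain rule for changes of charts. The two maps agree only near the image of \<open>q\<close>, on the common
  domain of all three charts.\<close>

lemma transition_cocycle:
  assumes A: "smooth_atlas A" and cde: "c \<in> A" "d \<in> A" "e \<in> A"
    and q: "q \<in> fst c" "q \<in> fst d" "q \<in> fst e"
  shows "frechet_derivative (snd e \<circ> cinv d) (at (snd d q))
      (frechet_derivative (snd d \<circ> cinv c) (at (snd c q)) v)
    = frechet_derivative (snd e \<circ> cinv c) (at (snd c q)) v"
proof -
  have g: "(snd d \<circ> cinv c) (snd c q) = snd d q" using cinv_chart[OF A cde(1) q(1)] by simp
  have d1: "(snd d \<circ> cinv c) differentiable (at (snd c q))"
    by (rule transition_differentiable[OF A cde(1,2) q(1,2)])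
  have d2: "(snd e \<circ> cinv d) differentiable (at ((snd d \<circ> cinv c) (snd c q)))"
    unfolding g by (rule transition_differentiable[OF A cde(2,3) q(2,3)])
  let ?W = "snd c ` (fst d \<inter> fst e \<inter> fst c)"
  have "open (fst d)" "open (fst e)" using A cde unfolding smooth_atlas_def by blast+
  then have W: "open ?W" using open_chart_image[OF A cde(1)] by blast
  have "frechet_derivative ((snd e \<circ> cinv d) \<circ> (snd d \<circ> cinv c)) (at (snd c q))
      = frechet_derivative (snd e \<circ> cinv c) (at (snd c q))"
    using q cinv_chart[OF A cde(1)] cinv_chart[OF A cde(2)]
    by (intro frechet_derivative_transform_within_open[OF _ W] differentiable_chain_at[OF d1 d2]) auto
  then show ?thesis
    using frechet_derivative_compose[OF d1 d2] unfolding g by (metis comp_apply)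
qed

text \<open>The vector field with constant components \<open>v\<close> in the chart \<open>c\<close>. A tangent vector at \<open>q\<close> is recorded by
  its components in \<open>chart_at A q\<close>, hence the Jacobian.\<close>

definition coordinate_field ::
  "('m, 'k::finite) chart set \<Rightarrow> ('m, 'k) chart \<Rightarrow> real ^ 'k \<Rightarrow> 'm \<Rightarrow> real ^ 'k" where
  "coordinate_field A c v q =
     frechet_derivative (snd (chart_at A q) \<circ> cinv c) (at (snd c q)) v"

text \<open>By the cocycle rule the choice of charts \<open>chart_at A q\<close> cancels: the components in a chart \<open>d\<close> are
  the derivative of the transition map from \<open>c\<close> to \<open>d\<close> in the direction \<open>v\<close>, taken at a point that
  itself moves by a transition map.\<close>

lemma smooth_coordinate_field:
  assumes A: "smooth_atlas A" and c: "c \<in> A"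
  shows "smooth_vf A (fst c) (coordinate_field A c v)"
  unfolding smooth_vf_def smooth_on_def
proof (intro ballI allI)
  fix d k assume d: "d \<in> A"
  let ?S = "snd d ` (fst c \<inter> fst d)" and ?T = "snd c ` (fst c \<inter> fst d)"
  have "open (fst c)" using A c unfolding smooth_atlas_def by blast
  then have S: "open ?S" by (rule open_chart_image[OF A d])
  show "Ck_on k ?S (vf_repr A d (coordinate_field A c v))"
  proof (rule Ck_on_cong[OF S])
    show "Ck_on k ?S (\<lambda>u. frechet_derivative (snd d \<circ> cinv c) (at ((snd c \<circ> cinv d) u)) v)"
    proof (rule Ck_on_compose[OF S, where f = "snd c \<circ> cinv d"])
      show "(snd c \<circ> cinv d) ` ?S \<subseteq> ?T" using cinv_chart[OF A d] by auto
      show "Ck_on k ?S (snd c \<circ> cinv d)"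
        using smooth_transition[OF A d c] unfolding smooth_on_def by (simp add: Int_commute)
      have "Ck_on (Suc k) ?T (snd d \<circ> cinv c)"
        using smooth_transition[OF A c d] unfolding smooth_on_def by blast
      then show "Ck_on k ?T (\<lambda>u. frechet_derivative (snd d \<circ> cinv c) (at u) v)" by simp
    qed
    fix u assume "u \<in> ?S"
    then obtain q where q: "u = snd d q" "q \<in> fst c" "q \<in> fst d" by blast
    have "frechet_derivative (snd d \<circ> cinv (chart_at A q)) (at (snd (chart_at A q) q))
        (frechet_derivative (snd (chart_at A q) \<circ> cinv c) (at (snd c q)) v)
      = frechet_derivative (snd d \<circ> cinv c) (at (snd c q)) v"
      by (rule transition_cocycle[OF A c chart_at(1)[OF A] d q(2) chart_at(2)[OF A] q(3)])
    then show "frechet_derivative (snd d \<circ> cinv c) (at ((snd c \<circ> cinv d) u)) v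
        = vf_repr A d (coordinate_field A c v) u"
      using cinv_chart[OF A d q(3)] by (simp add: vf_repr_def coordinate_field_def q(1) Let_def)
  qed
qed

text \<open>The choice operator in \<open>local_ext\<close> has a witness, namely the coordinate field of the chart chosen
  at \<open>p\<close> itself, for which the Jacobian at \<open>p\<close> is the identity.\<close>

lemma local_ext:
  assumes A: "smooth_atlas A"
  shows "\<exists>U. open U \<and> p \<in> U \<and> smooth_vf A U (local_ext A p y)" "local_ext A p y p = y"
proof -
  let ?c = "chart_at A p"
  have c: "?c \<in> A" "p \<in> fst ?c" by (rule chart_at[OF A])+
  have o: "open (fst ?c)" using A c unfolding smooth_atlas_def by blast
  \<comment> \<open>The chart map composed with its inverse is the identity only on the image of the chart.\<close>
  have "frechet_derivative (\<lambda>u. u) (at (snd ?c p)) = frechet_derivative (snd ?c \<circ> cinv ?c) (at (snd ?c p))"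
    using open_chart_image[OF A c(1) o] c cinv_chart[OF A c(1)]
    by (intro frechet_derivative_transform_within_open[of _ _ "snd ?c ` (fst ?c \<inter> fst ?c)"]) auto
  then have "coordinate_field A ?c y p = y"
    by (metis coordinate_field_def frechet_derivative_ident)
  then have "\<exists>Y. (\<exists>U. open U \<and> p \<in> U \<and> smooth_vf A U Y) \<and> Y p = y"
    using smooth_coordinate_field[OF A c(1)] o c(2) by blast
  then have "(\<exists>U. open U \<and> p \<in> U \<and> smooth_vf A U (local_ext A p y)) \<and> local_ext A p y p = y"
    unfolding local_ext_def by (rule someI_ex)
  then show "\<exists>U. open U \<and> p \<in> U \<and> smooth_vf A U (local_ext A p y)" "local_ext A p y p = y"
    by auto
qed

lemma smooth_vf_scaleR:
  assumes A: "smooth_atlas A" and U: "open U" and h: "smooth_fun A U h" and X: "smooth_vf A U X"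
  shows "smooth_vf A U (\<lambda>q. h q *\<^sub>R X q)"
  unfolding smooth_vf_def smooth_on_def
proof (intro ballI allI)
  fix c k assume c: "c \<in> A"
  note S = open_chart_image[OF A c U]
  show "Ck_on k (snd c ` (U \<inter> fst c)) (vf_repr A c (\<lambda>q. h q *\<^sub>R X q))"
  proof (rule Ck_on_cong[OF S])
    show "Ck_on k (snd c ` (U \<inter> fst c)) (\<lambda>u. (h \<circ> cinv c) u *\<^sub>R vf_repr A c X u)"
    proof (rule Ck_on_scaleR[OF S, where f = "h \<circ> cinv c"])
      show "Ck_on k (snd c ` (U \<inter> fst c)) (h \<circ> cinv c)"
        using h c unfolding smooth_fun_def smooth_on_def by blast
      show "Ck_on k (snd c ` (U \<inter> fst c)) (vf_repr A c X)"
        using X c unfolding smooth_vf_def smooth_on_def by blast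
    qed
    fix u assume "u \<in> snd c ` (U \<inter> fst c)"
    then obtain q where q: "u = snd c q" "q \<in> fst c" by blast
    have "linear (frechet_derivative (snd c \<circ> cinv (chart_at A q)) (at (snd (chart_at A q) q)))"
      by (intro linear_frechet_derivative transition_differentiable[OF A] chart_at[OF A] c q(2))
    then show "(h \<circ> cinv c) u *\<^sub>R vf_repr A c X u = vf_repr A c (\<lambda>q. h q *\<^sub>R X q) u"
      using cinv_chart[OF A c q(2)] by (simp add: vf_repr_def q(1) Let_def linear_cmul)
  qed
qed

section \<open>The fundamental tensor on the manifold\<close>

locale apapr_levi_civita =
  fixes M :: "('m::{t2_space, second_countable_topology}, 'k::finite) apapr"
    and D :: "('m, 'k) connection" and n :: nat
  assumes manifold: "apapr_manifold n M" and levi_civita: "levi_civita (atlas M) (metr M) D"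
begin

lemma atlas: "smooth_atlas (atlas M)"
  using manifold by (simp add: apapr_manifold_def)

lemma tangent_space: "apapr_space (metr M p) (phi M p) (xi M p) (eta M p)"
proof (intro apapr_space.intro inner_form.intro apapr_space_axioms.intro)
  fix x y
  note M = manifold[unfolded apapr_manifold_def]
  have "linear (phi M q)" for q using M by (elim conjE) (erule spec)
  then show "linear (phi M p)" .
  have "linear (eta M q)" for q using M by (elim conjE) (erule spec)
  then show "linear (eta M p)" .
  have "riemannian_metric (atlas M) (metr M)" using M by (elim conjE)
  then have metric: "bilinear (metr M p) \<and> (\<forall>x y. metr M p x y = metr M p y x) \<and>
      (\<forall>x. x \<noteq> 0 \<longrightarrow> metr M p x x > 0)"
    unfolding riemannian_metric_def by (elim conjE) (erule spec)
  show "bilinear (metr M p)" using metric by (rule conjunct1)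
  show "metr M p x y = metr M p y x" using metric by (elim conjE) (erule allE, erule spec)
  show "metr M p x x > 0" if "x \<noteq> 0" using metric that by (elim conjE) (erule allE, erule mp)
  have "\<forall>p. phi M p (xi M p) = 0 \<and>
          (\<forall>x. phi M p (phi M p x) = x - eta M p x *\<^sub>R xi M p) \<and>
          (\<forall>x. eta M p (phi M p x) = 0) \<and>
          eta M p (xi M p) = 1 \<and>
          trace (matrix (phi M p)) = 0 \<and>
          (\<forall>x y. metr M p (phi M p x) (phi M p y) = metr M p x y - eta M p x * eta M p y) \<and>
          (\<forall>x. metr M p x (xi M p) = eta M p x)"
    using M by (elim conjE)
  note pointwise = this[THEN spec, of p]
  show "phi M p (xi M p) = 0" using pointwise by (elim conjE)
  show "phi M p (phi M p x) = x - eta M p x *\<^sub>R xi M p" using pointwise by (elim conjE) (erule spec)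
  show "eta M p (phi M p x) = 0" using pointwise by (elim conjE) (erule spec)
  show "eta M p (xi M p) = 1" using pointwise by (elim conjE)
  show "trace (matrix (phi M p)) = 0" using pointwise by (elim conjE)
  show "metr M p (phi M p x) (phi M p y) = metr M p x y - eta M p x * eta M p y"
    using pointwise by (elim conjE) (erule allE, erule spec)
  show "metr M p x (xi M p) = eta M p x" using pointwise by (elim conjE) (erule spec)
qed

sublocale tangent: apapr_space "metr M p" "phi M p" "xi M p" "eta M p" for p
  by (rule tangent_space)

lemma smooth_phi: "open U \<Longrightarrow> smooth_vf (atlas M) U X \<Longrightarrow> smooth_vf (atlas M) U (\<lambda>q. phi M q (X q))"
  using manifold by (simp add: apapr_manifold_def)

lemma smooth_eta: "open U \<Longrightarrow> smooth_vf (atlas M) U X \<Longrightarrow> smooth_fun (atlas M) U (\<lambda>q. eta M q (X q))"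
  using manifold by (simp add: apapr_manifold_def)

lemma smooth_xi: "smooth_vf (atlas M) U (xi M)"
proof (rule smooth_vf_subset)
  show "smooth_vf (atlas M) UNIV (xi M)"
    using manifold by (simp add: apapr_manifold_def)
qed simp

lemma connection_affine: "affine_connection (atlas M) D"
  using levi_civita by (simp add: levi_civita_def)

lemma connection_linear:
  assumes "open U" "smooth_vf (atlas M) U Y" "p \<in> U"
  shows "linear (\<lambda>v. D p v Y)"
  using connection_affine[unfolded affine_connection_def, THEN spec, THEN spec, THEN mp,
      OF conjI[OF assms(1,2)]] assms(3) by (elim conjE) (erule bspec)

lemma connection_add:
  assumes "open U" "smooth_vf (atlas M) U Y" "smooth_vf (atlas M) U Z" "p \<in> U"
  shows "D p v (\<lambda>q. Y q + Z q) = D p v Y + D p v Z"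
proof -
  have "\<forall>Z. smooth_vf (atlas M) U Z \<longrightarrow> (\<forall>p\<in>U. \<forall>v. D p v (\<lambda>q. Y q + Z q) = D p v Y + D p v Z)"
    using connection_affine[unfolded affine_connection_def, THEN spec, THEN spec, THEN mp,
        OF conjI[OF assms(1,2)]] by (elim conjE)
  from this[THEN spec, THEN mp, OF assms(3), THEN bspec, OF assms(4), THEN spec] show ?thesis .
qed

lemma connection_leibniz:
  assumes "open U" "smooth_vf (atlas M) U Y" "smooth_fun (atlas M) U h" "p \<in> U"
  shows "D p v (\<lambda>q. h q *\<^sub>R Y q) = dir_deriv (atlas M) p v h *\<^sub>R Y p + h p *\<^sub>R D p v Y"
proof -
  have "\<forall>h. smooth_fun (atlas M) U h \<longrightarrow> (\<forall>p\<in>U. \<forall>v.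
      D p v (\<lambda>q. h q *\<^sub>R Y q) = dir_deriv (atlas M) p v h *\<^sub>R Y p + h p *\<^sub>R D p v Y)"
    using connection_affine[unfolded affine_connection_def, THEN spec, THEN spec, THEN mp,
        OF conjI[OF assms(1,2)]] by (elim conjE)
  from this[THEN spec, THEN mp, OF assms(3), THEN bspec, OF assms(4), THEN spec] show ?thesis .
qed

lemma connection_metric:
  assumes "open U" "smooth_vf (atlas M) U Y" "smooth_vf (atlas M) U Z" "p \<in> U"
  shows "dir_deriv (atlas M) p v (\<lambda>q. metr M q (Y q) (Z q))
    = metr M p (D p v Y) (Z p) + metr M p (Y p) (D p v Z)"
proof -
  have "metric_compatible (atlas M) (metr M) D"
    using levi_civita by (simp add: levi_civita_def)
  from this[unfolded metric_compatible_def, THEN spec, THEN spec, THEN spec, THEN mp,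
      OF conjI[OF assms(1) conjI[OF assms(2,3)]], THEN bspec, OF assms(4), THEN spec]
  show ?thesis .
qed

lemma connection_zero: "D p v (\<lambda>q. 0) = 0"
proof -
  have "smooth_vf (atlas M) UNIV (\<lambda>q. 0)"
    using smooth_phi[OF _ smooth_xi, of UNIV] by (simp add: tangent.f_xi)
  from connection_add[OF _ this this, of p v] show ?thesis by simp
qed

text \<open>The expression that \<open>nabla_phi\<close> evaluates, for a freely chosen vector field in place of \<open>local_ext\<close>.\<close>

definition nabla_phi_field :: "'m \<Rightarrow> real ^ 'k \<Rightarrow> ('m \<Rightarrow> real ^ 'k) \<Rightarrow> real ^ 'k" where
  "nabla_phi_field p x Y = D p x (\<lambda>q. phi M q (Y q)) - phi M p (D p x Y)"

text \<open>\<open>g(\<phi>Y,Z)\<close> and \<open>g(Y,\<phi>Z)\<close> are the same function, so their derivatives along \<open>x\<close>, computed by metric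
  compatibility, agree.\<close>

lemma nabla_phi_field_self_adjoint:
  assumes "open U" "p \<in> U" "smooth_vf (atlas M) U Y" "smooth_vf (atlas M) U Z"
  shows "metr M p (nabla_phi_field p x Y) (Z p) = metr M p (Y p) (nabla_phi_field p x Z)"
proof -
  have "(\<lambda>q. metr M q (phi M q (Y q)) (Z q)) = (\<lambda>q. metr M q (Y q) (phi M q (Z q)))"
    by (simp add: tangent.f_self_adjoint)
  then have "metr M p (D p x (\<lambda>q. phi M q (Y q))) (Z p) + metr M p (phi M p (Y p)) (D p x Z)
      = metr M p (D p x Y) (phi M p (Z p)) + metr M p (Y p) (D p x (\<lambda>q. phi M q (Z q)))"
    using connection_metric[OF assms(1) smooth_phi[OF assms(1,3)] assms(4,2), of x]
      connection_metric[OF assms(1,3) smooth_phi[OF assms(1,4)] assms(2), of x] by simp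
  then show ?thesis
    by (simp add: nabla_phi_field_def tangent.g_simps tangent.f_self_adjoint)
qed

text \<open>Tensoriality in the differentiated argument. By self-adjointness the pairing of either side with \<open>z\<close>
  equals the pairing of \<open>Y p\<close> with a vector that depends only on \<open>z\<close>. Without this, \<open>\<phi> Y\<close> could not be
  used as the extension of \<open>\<phi> y\<close>.\<close>

lemma nabla_phi_eq:
  assumes "open U" "p \<in> U" "smooth_vf (atlas M) U Y"
  shows "nabla_phi M D p x (Y p) = nabla_phi_field p x Y"
proof (rule tangent.eq_if_g_eq)
  fix z
  obtain V where V: "open V" "p \<in> V" "smooth_vf (atlas M) V (local_ext (atlas M) p z)"
    using local_ext(1)[OF atlas] by blast
  obtain W where W: "open W" "p \<in> W" "smooth_vf (atlas M) W (local_ext (atlas M) p (Y p))"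
    using local_ext(1)[OF atlas] by blast
  have o: "open (U \<inter> V \<inter> W)" "p \<in> U \<inter> V \<inter> W" using assms V W by auto
  have s: "smooth_vf (atlas M) (U \<inter> V \<inter> W) Y" "smooth_vf (atlas M) (U \<inter> V \<inter> W) (local_ext (atlas M) p z)"
     "smooth_vf (atlas M) (U \<inter> V \<inter> W) (local_ext (atlas M) p (Y p))"
    using assms V W by (auto intro: smooth_vf_subset)
  show "metr M p (nabla_phi M D p x (Y p)) z = metr M p (nabla_phi_field p x Y) z"
    using nabla_phi_field_self_adjoint[OF o s(1,2), of x] nabla_phi_field_self_adjoint[OF o s(3,2), of x]
    by (simp add: local_ext(2)[OF atlas] nabla_phi_def nabla_phi_field_def Let_def)
qed

lemma fund_eq: "fund M D p x y z = metr M p (nabla_phi_field p x (local_ext (atlas M) p y)) z"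
  by (simp add: fund_def nabla_phi_def nabla_phi_field_def Let_def)

lemma fund_sym: "fund M D p x y z = fund M D p x z y"
proof -
  let ?Y = "local_ext (atlas M) p y" and ?Z = "local_ext (atlas M) p z"
  obtain V where V: "open V" "p \<in> V" "smooth_vf (atlas M) V ?Y"
    using local_ext(1)[OF atlas] by blast
  obtain W where W: "open W" "p \<in> W" "smooth_vf (atlas M) W ?Z"
    using local_ext(1)[OF atlas] by blast
  have o: "open (V \<inter> W)" "p \<in> V \<inter> W" using V W by auto
  have s: "smooth_vf (atlas M) (V \<inter> W) ?Y" "smooth_vf (atlas M) (V \<inter> W) ?Z"
    using V W by (auto intro: smooth_vf_subset)
  have "fund M D p x y z = metr M p (nabla_phi_field p x ?Y) (?Z p)"
    by (simp only: fund_eq local_ext(2)[OF atlas])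
  also have "\<dots> = metr M p (?Y p) (nabla_phi_field p x ?Z)"
    by (rule nabla_phi_field_self_adjoint[OF o s])
  also have "\<dots> = metr M p (nabla_phi_field p x ?Z) (?Y p)"
    by (rule tangent.g_sym)
  also have "\<dots> = fund M D p x z y"
    by (simp only: fund_eq local_ext(2)[OF atlas])
  finally show ?thesis .
qed

lemma fund_linear3: "linear (\<lambda>z. fund M D p x y z)"
  using tangent.bil[of p] by (simp add: bilinear_def fund_def)

text \<open>Linearity in \<open>y\<close> is not visible from the definition, since the chosen extensions need not depend
  linearly on \<open>y\<close>; symmetry transfers it from the last argument.\<close>

lemma fund_linear2: "linear (\<lambda>y. fund M D p x y z)"
proof -
  have "(\<lambda>y. fund M D p x y z) = (\<lambda>y. fund M D p x z y)"
    by (rule ext) (rule fund_sym)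
  then show ?thesis using fund_linear3 by simp
qed

lemma fund_linear1: "linear (\<lambda>x. fund M D p x y z)"
proof -
  let ?Y = "local_ext (atlas M) p y"
  obtain U where U: "open U" "p \<in> U" "smooth_vf (atlas M) U ?Y"
    using local_ext(1)[OF atlas] by blast
  have "linear (\<lambda>x. D p x (\<lambda>q. phi M q (?Y q)))"
    by (rule connection_linear[OF U(1) smooth_phi[OF U(1,3)] U(2)])
  moreover have "linear (\<lambda>x. phi M p (D p x ?Y))"
    using linear_compose[OF connection_linear[OF U(1,3,2)] tangent.lin_f] by (simp add: o_def)
  ultimately have "linear (\<lambda>x. nabla_phi_field p x ?Y)"
    unfolding nabla_phi_field_def by (rule linear_compose_sub)
  moreover have "linear (\<lambda>v. metr M p v z)"
    using tangent.bil[of p] by (simp add: bilinear_def)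
  ultimately show ?thesis
    unfolding fund_eq using linear_compose by (fastforce simp: o_def)
qed

text \<open>Differentiate \<open>Y = \<phi>\<^sup>2Y + \<eta>(Y)\<xi>\<close> along \<open>x\<close>. The derivative of \<open>\<eta>(Y) = g(Y,\<xi>)\<close> comes from metric
  compatibility.\<close>

lemma nabla_phi_phi:
  "nabla_phi M D p x (phi M p y) + phi M p (nabla_phi M D p x y)
    = - metr M p y (D p x (xi M)) *\<^sub>R xi M p - eta M p y *\<^sub>R D p x (xi M)"
proof -
  let ?Y = "local_ext (atlas M) p y"
  obtain U where U: "open U" "p \<in> U" "smooth_vf (atlas M) U ?Y"
    using local_ext(1)[OF atlas] by blast
  have y: "?Y p = y" by (rule local_ext(2)[OF atlas])
  have sp: "smooth_vf (atlas M) U (\<lambda>q. phi M q (?Y q))" by (rule smooth_phi[OF U(1,3)])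
  have se: "smooth_fun (atlas M) U (\<lambda>q. eta M q (?Y q))" by (rule smooth_eta[OF U(1,3)])
  have "D p x ?Y = D p x (\<lambda>q. phi M q (phi M q (?Y q)) + eta M q (?Y q) *\<^sub>R xi M q)"
    by (simp add: tangent.f_f)
  also have "\<dots> = D p x (\<lambda>q. phi M q (phi M q (?Y q))) + D p x (\<lambda>q. eta M q (?Y q) *\<^sub>R xi M q)"
    by (intro connection_add[OF U(1)] smooth_phi[OF U(1)] sp U(2)
        smooth_vf_scaleR[OF atlas U(1) se smooth_xi])
  also have "D p x (\<lambda>q. eta M q (?Y q) *\<^sub>R xi M q)
      = dir_deriv (atlas M) p x (\<lambda>q. eta M q (?Y q)) *\<^sub>R xi M p + eta M p y *\<^sub>R D p x (xi M)"
    using connection_leibniz[OF U(1) smooth_xi se U(2)] y by simp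
  also have "dir_deriv (atlas M) p x (\<lambda>q. eta M q (?Y q)) = eta M p (D p x ?Y) + metr M p y (D p x (xi M))"
    using connection_metric[OF U(1,3) smooth_xi U(2), of x] y by (simp add: tangent.g_xi)
  finally have DY: "D p x ?Y = D p x (\<lambda>q. phi M q (phi M q (?Y q)))
      + ((eta M p (D p x ?Y) + metr M p y (D p x (xi M))) *\<^sub>R xi M p + eta M p y *\<^sub>R D p x (xi M))" .
  have "D p x (\<lambda>q. phi M q (phi M q (?Y q))) = D p x ?Y
      - ((eta M p (D p x ?Y) + metr M p y (D p x (xi M))) *\<^sub>R xi M p + eta M p y *\<^sub>R D p x (xi M))"
    by (rule eq_diff_eq[THEN iffD2], rule DY[symmetric])
  moreover have "nabla_phi M D p x (phi M p y)
      = D p x (\<lambda>q. phi M q (phi M q (?Y q))) - phi M p (D p x (\<lambda>q. phi M q (?Y q)))"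
    using nabla_phi_eq[OF U(1,2) sp, of x] y by (simp add: nabla_phi_field_def)
  moreover have "phi M p (nabla_phi M D p x y)
      = phi M p (D p x (\<lambda>q. phi M q (?Y q))) - (D p x ?Y - eta M p (D p x ?Y) *\<^sub>R xi M p)"
    by (simp add: nabla_phi_def Let_def linear_diff[OF tangent.lin_f] tangent.f_f)
  ultimately show ?thesis by (simp only:) (simp add: algebra_simps)
qed

lemma nabla_phi_xi: "nabla_phi M D p x (xi M p) = - phi M p (D p x (xi M))"
  using nabla_phi_eq[OF open_UNIV UNIV_I smooth_xi, of p x]
  by (simp add: nabla_phi_field_def tangent.f_xi connection_zero)

text \<open>Pairing \<open>nabla_phi_phi\<close> with \<open>\<phi>z\<close> removes the multiples of \<open>\<xi>\<close>, and \<open>g(\<nabla>\<^sub>x\<xi>,\<phi>z)\<close> is \<open>- F(x,\<xi>,z)\<close>.\<close>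

lemma fund_phi_phi:
  "fund M D p x (phi M p y) (phi M p z)
    = - fund M D p x y z + eta M p y * fund M D p x (xi M p) z + eta M p z * fund M D p x y (xi M p)"
proof -
  have "metr M p (nabla_phi M D p x (phi M p y) + phi M p (nabla_phi M D p x y)) (phi M p z)
      = - eta M p y * metr M p (D p x (xi M)) (phi M p z)"
    unfolding nabla_phi_phi
    by (simp add: tangent.g_simps tangent.g_xi_left tangent.eta_f)
  moreover have "metr M p (nabla_phi M D p x (xi M p)) z = - metr M p (D p x (xi M)) (phi M p z)"
    by (simp add: nabla_phi_xi tangent.g_simps tangent.f_self_adjoint)
  ultimately show ?thesis
    unfolding fund_def by (simp add: tangent.g_simps tangent.g_f_f tangent.g_xi algebra_simps)
qed

lemma fundamental_form: "fundamental_form (metr M p) (phi M p) (xi M p) (eta M p) (fund M D p)"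
proof (intro fundamental_form.intro fundamental_form_axioms.intro tangent_space)
  fix x y z
  show "linear (\<lambda>x. fund M D p x y z)" by (rule fund_linear1)
  show "linear (\<lambda>y. fund M D p x y z)" by (rule fund_linear2)
  show "linear (\<lambda>z. fund M D p x y z)" by (rule fund_linear3)
  show "fund M D p x y z = fund M D p x z y" by (rule fund_sym)
  show "fund M D p x (phi M p y) (phi M p z) = - fund M D p x y z
      + eta M p y * fund M D p x (xi M p) z + eta M p z * fund M D p x y (xi M p)"
    by (rule fund_phi_phi)
qed

sublocale tangent: fundamental_form "metr M p" "phi M p" "xi M p" "eta M p" "fund M D p" for p
  by (rule fundamental_form)

text \<open>The existence of an orthonormal basis \<open>B\<close> is what makes the choice in \<open>ker_basis\<close> meaningful; the
  sum over the chosen basis is then the sum over \<open>B\<close>.\<close>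

lemma sum_ker_basis:
  assumes B: "orthonormal_basis_ker M p B" and T: "bilinear T"
  shows "(\<Sum>e\<in>ker_basis M p. T e e) = (\<Sum>e\<in>B. T e e :: real)"
proof -
  have K: "orthonormal_basis_ker M p (ker_basis M p)"
    unfolding ker_basis_def using B by (rule someI)
  show ?thesis
  proof (rule tangent.orthonormal_sum_unique[where p = p and T = T])
    show "span (ker_basis M p) = span B" "bilinear T"
      using B K T by (simp_all add: orthonormal_basis_ker_def)
  qed (use B K in \<open>auto simp: orthonormal_basis_ker_def\<close>)
qed

lemma lee_theta_eq:
  assumes "orthonormal_basis_ker M p B"
  shows "lee_theta M D p z = (\<Sum>e\<in>B. fund M D p e e z)"
  unfolding lee_theta_def using fund_linear1 fund_linear2
  by (intro sum_ker_basis[OF assms, where T = "\<lambda>x y. fund M D p x y z"]) (simp add: bilinear_def)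

lemma lee_theta_star_eq:
  assumes "orthonormal_basis_ker M p B"
  shows "lee_theta_star M D p z = (\<Sum>e\<in>B. fund M D p e (phi M p e) z)"
  unfolding lee_theta_star_def
  using fund_linear1 linear_compose[OF tangent.lin_f fund_linear2]
  by (intro sum_ker_basis[OF assms, where T = "\<lambda>x y. fund M D p x (phi M p y) z"])
    (simp add: bilinear_def o_def)

end

section \<open>The classification in dimension 3\<close>

theorem theorem3p2:
  fixes M :: "('m::{t2_space, second_countable_topology}, 'k::finite) apapr"
    and D :: "('m, 'k) connection"
  assumes "apapr_manifold 1 M"
    and "levi_civita (atlas M) (metr M) D"
  shows "in_class 1 M D {1, 4, 5, 8, 9, 10, 11}"
proof -
  interpret apapr_levi_civita M D 1 using assms by unfold_locales
  have dim: "CARD('k) = 3" using assms(1) unfolding apapr_manifold_def by simp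
  have "fund M D p x y z = F1 1 M D p x y z + F4 1 M D p x y z + F5 1 M D p x y z + F8 1 M D p x y z
      + F9 1 M D p x y z + F10 1 M D p x y z + F11 1 M D p x y z" for p x y z
  proof -
    obtain e1 e2 where e: "phi M p e1 = e1" "phi M p e2 = - e2" "metr M p e1 e1 = 1" "metr M p e2 e2 = 1"
        "metr M p e1 e2 = 0" "eta M p e1 = 0" "eta M p e2 = 0"
      and frame: "\<And>x. x = eta M p x *\<^sub>R xi M p + metr M p x e1 *\<^sub>R e1 + metr M p x e2 *\<^sub>R e2"
      using tangent.eigenframe[OF dim] by blast
    have ne: "e1 \<noteq> e2" using e by auto
    have e21: "metr M p e2 e1 = 0" using e(5) tangent.g_sym by metis
    have B: "orthonormal_basis_ker M p {e1, e2}"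
      unfolding orthonormal_basis_ker_def using tangent.span_eigenframe[OF e(6,7) frame] e(3-5) e21 ne by auto
    note F = tangent.F_eigenframe[OF e(1,2) frame]
    have phi1: "metr M p (phi M p w) e1 = metr M p w e1" for w
      by (simp add: tangent.f_self_adjoint e)
    have phi2: "metr M p (phi M p w) e2 = - metr M p w e2" for w
      by (simp add: tangent.f_self_adjoint e tangent.g_simps)
    have xi0: "metr M p (xi M p) e1 = 0" "metr M p (xi M p) e2 = 0"
      using tangent.g_xi[of p e1] tangent.g_xi[of p e2] e tangent.g_sym by metis+
    have g: "metr M p v w = eta M p v * eta M p w + metr M p v e1 * metr M p w e1 + metr M p v e2 * metr M p w e2" for v w
    proof -
      have "metr M p v w = metr M p v (eta M p w *\<^sub>R xi M p + metr M p w e1 *\<^sub>R e1 + metr M p w e2 *\<^sub>R e2)"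
        using frame[of w] by simp
      then show ?thesis by (simp add: tangent.g_simps tangent.g_xi mult.commute)
    qed
    \<comment> \<open>The nine independent entries of \<open>F\<close>: those of the form \<open>F(x,e\<^sub>1,e\<^sub>2)\<close> are called \<open>a\<close>, those of the
      form \<open>F(x,e\<^sub>i,\<xi>)\<close> are called \<open>bi\<close>; a last digit \<open>j\<close> stands for \<open>x = e\<^sub>j\<close> and its absence for \<open>x = \<xi>\<close>.\<close>
    define a where "a = fund M D p (xi M p) e1 e2"
    define a1 where "a1 = fund M D p e1 e1 e2"
    define a2 where "a2 = fund M D p e2 e1 e2"
    define b1 where "b1 = fund M D p (xi M p) e1 (xi M p)"
    define b11 where "b11 = fund M D p e1 e1 (xi M p)"
    define b12 where "b12 = fund M D p e2 e1 (xi M p)"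
    define b2 where "b2 = fund M D p (xi M p) e2 (xi M p)"
    define b21 where "b21 = fund M D p e1 e2 (xi M p)"
    define b22 where "b22 = fund M D p e2 e2 (xi M p)"
    have F': "fund M D p x y z =
      (eta M p x * a + metr M p x e1 * a1 + metr M p x e2 * a2)
        * (metr M p y e1 * metr M p z e2 + metr M p y e2 * metr M p z e1) +
      (eta M p x * b1 + metr M p x e1 * b11 + metr M p x e2 * b12)
        * (metr M p y e1 * eta M p z + eta M p y * metr M p z e1) +
      (eta M p x * b2 + metr M p x e1 * b21 + metr M p x e2 * b22)
        * (metr M p y e2 * eta M p z + eta M p y * metr M p z e2)" for x y z
      unfolding a_def a1_def a2_def b1_def b2_def b11_def b12_def b21_def b22_def by (rule F)
    have th: "lee_theta M D p w = a1 * metr M p w e2 + a2 * metr M p w e1 + (b11 + b22) * eta M p w" for w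
      unfolding lee_theta_eq[OF B] using ne by (simp add: F' e e21 algebra_simps)
    have ths: "lee_theta_star M D p (xi M p) = b11 - b22"
      unfolding lee_theta_star_eq[OF B] using ne
      by (simp add: F' e e21 xi0 tangent.eta_xi tangent.g_simps linear_neg[OF tangent.lin_eta])
    have gff: "metr M p (phi M p u) (phi M p w) = metr M p u e1 * metr M p w e1 + metr M p u e2 * metr M p w e2"
      "metr M p u (phi M p w) = metr M p u e1 * metr M p w e1 - metr M p u e2 * metr M p w e2" for u w
      using g[of "phi M p u" "phi M p w"] g[of u "phi M p w"] by (simp_all add: tangent.eta_f phi1 phi2)
    show ?thesis
      unfolding F1_def F4_def F5_def F8_def F9_def F10_def F11_def Let_def tens_br_def tens_b_def tens_c_def
        lee_omega_def th ths F' gff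
      unfolding phi1 phi2 xi0 tangent.eta_f tangent.eta_xi
      by (simp add: field_simps)
  qed
  then show ?thesis unfolding in_class_def fund_comp_def by simp
qed

end
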